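(* Let $n = pq$, where $p, q$ are positive integers with $\gcd(p,q) = 1$. Let $s, t \in \{1, \ldots, n-1\}$ be such that $$2s,\ 2t,\ 2(s+t),\ 3s-t,\ 3t-s,\ 3s+t,\ 3t+s,\ 4s,\ 4t \not\equiv 0 \pmod n.$$ If $s = \frac{p-q}{2}$ and $t = \frac{p+q}{2}$, or $s = \frac{p^2-q}{2}$ and $t = \frac{p^2+q}{2}$, then $\mathcal{N}(C_n(s,t))$ is homotopy equivalent to a torus.
   Context: For an integer $n\ge 2$ and $s,t\in\{1,\ldots,n-1\}$, the circulant graph $C_n(s,t)$ is the simple graph with vertex set $\{1,2,\ldots,n\}$ in which two vertices $x,y$ are adjacent if and only if $x-y \pmod n$ lies in $\{s, t, n-s, n-t\}$. The neighborhood complex $\mathcal{N}(G)$ of a graph $G$ is the (abstract) simplicial complex whose vertices are all non-isolated vertices of $G$ and whose simplices are those subsets of $V(G)$ which have a common neighbor in $G$. Topological statements about a simplicial complex refer to its geometric realization. The torus is $S^1\times S^1$. *)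

theory Defs
  imports
    "HOL-Analysis.Analysis"
    "HOL-Number_Theory.Cong"
    "Graph_Theory.Pair_Digraph"
begin

text \<open>
  A simple graph is a \<^locale>\<open>pair_graph\<close>: finite, loopless, and with each undirected edge
  represented by both of its orientations.  Vertices are integers so that the difference
  \<open>x - y\<close> is not truncated.
\<close>

definition circulant_graph :: "int \<Rightarrow> int \<Rightarrow> int \<Rightarrow> int pair_pre_digraph" where
  "circulant_graph n s t =
     \<lparr> pverts = {1..n},
       parcs = {(x, y). x \<in> {1..n} \<and> y \<in> {1..n} \<and> (x - y) mod n \<in> {s, t, n - s, n - t}} \<rparr>"

lemma pair_graph_circulant_graph:
  assumes "s \<in> {1..n - 1}" and "t \<in> {1..n - 1}"
  shows "pair_graph (circulant_graph n s t)"
proof -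
  let ?G = "circulant_graph n s t"
  have sym: "(y - x) mod n \<in> {s, t, n - s, n - t}"
    if *: "(x - y) mod n \<in> {s, t, n - s, n - t}" for x y :: int
  proof -
    have "(x - y) mod n \<noteq> 0" using * assms by auto
    moreover have "y - x = - (x - y)" by simp
    ultimately have "(y - x) mod n = n - (x - y) mod n"
      by (simp only: zmod_zminus1_eq_if if_False)
    then show ?thesis using * by auto
  qed
  show ?thesis
  proof
    fix e assume "e \<in> parcs ?G"
    then show "fst e \<in> pverts ?G" and "snd e \<in> pverts ?G"
      by (auto simp: circulant_graph_def)
  next
    show "finite (pverts ?G)" by (simp add: circulant_graph_def)
    show "finite (parcs ?G)"
      by (rule finite_subset[of _ "{1..n} \<times> {1..n}"]) (auto simp: circulant_graph_def)
  next
    fix e assume "e \<in> parcs ?G"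
    then show "fst e \<noteq> snd e"
      using assms by (auto simp: circulant_graph_def)
  next
    have "(y, x) \<in> parcs ?G" if "(x, y) \<in> parcs ?G" for x y
      using that sym[of x y] by (simp add: circulant_graph_def)
    then show "symmetric (with_proj ?G)"
      unfolding symmetric_def by (simp add: sym_def)
  qed
qed

text \<open>
  The empty set is counted as a simplex here; it contributes no point to the geometric
  realization below.
\<close>

definition neighborhood_complex :: "'a pair_pre_digraph \<Rightarrow> 'a set set" where
  "neighborhood_complex G =
     {A. A \<subseteq> pverts G \<and> (\<exists>w \<in> pverts G. \<forall>v \<in> A. (v, w) \<in> parcs G)}"

lemma neighborhood_complex_downward_closed:
  "A \<in> neighborhood_complex G \<Longrightarrow> B \<subseteq> A \<Longrightarrow> B \<in> neighborhood_complex G"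
  by (auto simp: neighborhood_complex_def)

lemma vertices_neighborhood_complex:
  "\<Union> (neighborhood_complex G) = {v \<in> pverts G. \<exists>w \<in> pverts G. (v, w) \<in> parcs G}"
proof -
  have "\<exists>A \<in> neighborhood_complex G. v \<in> A"
    if "v \<in> pverts G" "w \<in> pverts G" "(v, w) \<in> parcs G" for v w
    using that by (intro bexI[of _ "{v}"]) (auto simp: neighborhood_complex_def)
  then show ?thesis by (auto simp: neighborhood_complex_def)
qed

text \<open>
  Points are given by barycentric coordinates: nonnegative functions on the vertices with sum 1
  whose support is a simplex (an infinite support is excluded, since the sum over it is 0 by
  convention).  The topology is that of coordinatewise convergence; on a finite complex, the
  only case used, it is the usual
  (coherent) topology of the realization.
\<close>

definition geometric_realization :: "'a set set \<Rightarrow> ('a \<Rightarrow> real) topology" where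
  "geometric_realization K =
     subtopology (powertop_real UNIV)
       {x. (\<forall>v. 0 \<le> x v) \<and> {v. x v \<noteq> 0} \<in> K \<and> (\<Sum>v \<in> {v. x v \<noteq> 0}. x v) = 1}"

definition torus :: "(complex \<times> complex) topology" where
  "torus = prod_topology (top_of_set (sphere 0 1)) (top_of_set (sphere 0 1))"

end

theory Submission
  imports Defs
begin

text \<open>
  Put \<open>a = s + t\<close> and \<open>b = t - s\<close>.  The neighbourhood of \<open>w\<close> is \<open>{u, u + a, u + b, u + a + b}\<close>
  with \<open>u = w - t\<close>.  In all cases \<open>p\<close> divides \<open>a\<close>, \<open>q\<close> divides \<open>b\<close>, \<open>a\<close> is a unit modulo \<open>q\<close>
  and \<open>b\<close> is a unit modulo \<open>p\<close>, so by the Chinese remainder theorem the vertices form the grid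
  \<open>\<int>/q \<times> \<int>/p\<close> and the facets are the unit squares of that grid.  Hence a set of vertices is a
  simplex iff its two projections are simplices of the cycles of lengths \<open>q\<close> and \<open>p\<close>.
  For such a categorical product of complexes, a point of the realization is a probability
  measure, and taking the two marginals is a homotopy equivalence onto the product of the
  realizations: product measures give an inverse, because a measure and the product of its
  marginals have supports with the same projections and so lie in a common simplex.
\<close>

section \<open>Realization of a categorical product\<close>

definition realization_points :: "'a set set \<Rightarrow> ('a \<Rightarrow> real) set" where
  "realization_points K =
     {x. (\<forall>v. 0 \<le> x v) \<and> {v. x v \<noteq> 0} \<in> K \<and> (\<Sum>v \<in> {v. x v \<noteq> 0}. x v) = 1}"

text \<open>The product topology is the type class topology on functions, so
  \<open>continuous_on\<close> and \<open>path\<close> apply to realizations.\<close>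

lemma geometric_realization_eq:
  "geometric_realization K = top_of_set (realization_points K)"
  by (simp add: geometric_realization_def realization_points_def euclidean_product_topology)

text \<open>Zero coordinates add nothing, so the sum over the varying support becomes one over the
  fixed set \<open>V\<close>, which is linear in \<open>x\<close>.\<close>

lemma realization_points_iff:
  assumes "finite V" "K \<subseteq> Pow V"
  shows "x \<in> realization_points K \<longleftrightarrow>
           (\<forall>v. 0 \<le> x v) \<and> {v. x v \<noteq> 0} \<in> K \<and> (\<Sum>v \<in> V. x v) = 1"
proof -
  have "(\<Sum>v \<in> {v. x v \<noteq> 0}. x v) = (\<Sum>v \<in> V. x v)" if "{v. x v \<noteq> 0} \<in> K"
    using that assms by (intro sum.mono_neutral_left) auto
  then show ?thesis by (auto simp: realization_points_def)
qed

lemma realization_points_outside: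
  assumes "K \<subseteq> Pow V" "x \<in> realization_points K" "v \<notin> V"
  shows "x v = 0"
  using assms by (auto simp: realization_points_def)

text \<open>The empty set may belong to \<open>K\<close>, but an empty sum is 0 and not 1.\<close>

lemma support_nonempty: "x \<in> realization_points K \<Longrightarrow> {v. x v \<noteq> 0} \<noteq> {}"
  unfolding realization_points_def by (metis (mono_tags, lifting) mem_Collect_eq sum.empty zero_neq_one)

text \<open>The push-forward of the measure \<open>x\<close> along \<open>f\<close>.\<close>

definition marginal :: "'a set \<Rightarrow> ('a \<Rightarrow> 'b) \<Rightarrow> ('a \<Rightarrow> real) \<Rightarrow> 'b \<Rightarrow> real" where
  "marginal V f x i = (\<Sum>v \<in> {v \<in> V. f v = i}. x v)"

lemma continuous_on_marginal: "continuous_on S (marginal V f)"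
  unfolding marginal_def
  by (intro continuous_intros continuous_on_subset[OF continuous_on_product_coordinates]) auto

text \<open>Nonnegative terms cannot cancel.\<close>

lemma support_marginal:
  assumes "finite V" "\<And>v. 0 \<le> x v" "{v. x v \<noteq> 0} \<subseteq> V"
  shows "{i. marginal V f x i \<noteq> 0} = f ` {v. x v \<noteq> 0}"
  using assms by (auto simp: marginal_def sum_nonneg_eq_0_iff)

lemma sum_marginal:
  assumes "finite V" "finite W" "f ` V \<subseteq> W"
  shows "(\<Sum>i \<in> W. marginal V f x i) = (\<Sum>v \<in> V. x v)"
  unfolding marginal_def using assms by (intro sum.group) auto

lemma marginal_in_realization_points:
  assumes "finite V" "finite W" "f ` V \<subseteq> W" "K \<subseteq> Pow V" "L \<subseteq> Pow W"
    and "\<And>A. A \<in> K \<Longrightarrow> f ` A \<in> L" and x: "x \<in> realization_points K"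
  shows "marginal V f x \<in> realization_points L"
proof -
  have nn: "\<And>v. 0 \<le> x v" and K: "{v. x v \<noteq> 0} \<in> K" and "(\<Sum>v \<in> V. x v) = 1"
    using x realization_points_iff[of V K x] assms by auto
  moreover have "{i. marginal V f x i \<noteq> 0} = f ` {v. x v \<noteq> 0}"
    using assms K nn by (intro support_marginal) auto
  ultimately show ?thesis
    using assms sum_marginal[of V W f x]
    by (simp add: realization_points_iff[of W L] marginal_def sum_nonneg)
qed

text \<open>Two edges yield a tetrahedron in \<open>K\<close> but only a square in the product of
  realizations, hence a homotopy equivalence and not a homeomorphism.\<close>

lemma geometric_realization_categorical_product:
  assumes fin: "finite V" "finite W1" "finite W2"
    and sub: "K \<subseteq> Pow V" "L1 \<subseteq> Pow W1" "L2 \<subseteq> Pow W2"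
    and bij: "bij_betw (\<lambda>v. (f v, g v)) V (W1 \<times> W2)"
    and K: "\<And>A. A \<subseteq> V \<Longrightarrow> A \<in> K \<longleftrightarrow> f ` A \<in> L1 \<and> g ` A \<in> L2"
  shows "geometric_realization K homotopy_equivalent_space
           prod_topology (geometric_realization L1) (geometric_realization L2)"
proof -
  define X where "X = realization_points K"
  define Y1 where "Y1 = realization_points L1"
  define Y2 where "Y2 = realization_points L2"
  \<comment> \<open>\<open>m\<close> takes the two marginals; \<open>r\<close> forms the product
    measure, extended by 0 because points are functions on the whole type.\<close>
  define m where "m = (\<lambda>x. (marginal V f x, marginal V g x))"
  define r where "r = (\<lambda>(y1, y2) v. if v \<in> V then y1 (f v) * y2 (g v) else 0 :: real)"
  note X_iff = realization_points_iff[OF fin(1) sub(1), folded X_def]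
  note Y1_iff = realization_points_iff[OF fin(2) sub(2), folded Y1_def]
  note Y2_iff = realization_points_iff[OF fin(3) sub(3), folded Y2_def]
  have fV: "f ` V \<subseteq> W1" and gV: "g ` V \<subseteq> W2"
    using bij by (auto simp: bij_betw_def)
  have supp_r: "{v. r (y1, y2) v \<noteq> 0} = {v \<in> V. f v \<in> {i. y1 i \<noteq> 0} \<and> g v \<in> {j. y2 j \<noteq> 0}}"
    for y1 y2 by (auto simp: r_def)
  \<comment> \<open>An empty side would empty the rectangle and with it the other projection;
    supports of points are nonempty.\<close>
  have img: "f ` {v \<in> V. f v \<in> A \<and> g v \<in> B} = A" "g ` {v \<in> V. f v \<in> A \<and> g v \<in> B} = B"
    if AB: "A \<noteq> {}" "B \<noteq> {}" "A \<subseteq> W1" "B \<subseteq> W2" for A B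
  proof -
    have *: "\<exists>v \<in> V. f v = i \<and> g v = j" if "i \<in> W1" "j \<in> W2" for i j
    proof -
      have "(i, j) \<in> (\<lambda>v. (f v, g v)) ` V" using bij that by (simp add: bij_betw_def)
      then show ?thesis by auto
    qed
    show "f ` {v \<in> V. f v \<in> A \<and> g v \<in> B} = A"
    proof
      show "A \<subseteq> f ` {v \<in> V. f v \<in> A \<and> g v \<in> B}"
      proof
        fix i assume i: "i \<in> A"
        obtain j where j: "j \<in> B" using AB by blast
        obtain v where "v \<in> V" "f v = i" "g v = j" using * AB i j by blast
        then show "i \<in> f ` {v \<in> V. f v \<in> A \<and> g v \<in> B}" using i j by blast
      qed
    qed auto
    show "g ` {v \<in> V. f v \<in> A \<and> g v \<in> B} = B"
    proof
      show "B \<subseteq> g ` {v \<in> V. f v \<in> A \<and> g v \<in> B}"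
      proof
        fix j assume j: "j \<in> B"
        obtain i where i: "i \<in> A" using AB by blast
        obtain v where "v \<in> V" "f v = i" "g v = j" using * AB i j by blast
        then show "j \<in> g ` {v \<in> V. f v \<in> A \<and> g v \<in> B}" using i j by blast
      qed
    qed auto
  qed
  have supp_Y1: "{i. y i \<noteq> 0} \<noteq> {} \<and> {i. y i \<noteq> 0} \<subseteq> W1" if "y \<in> Y1" for y
    using that support_nonempty sub(2) Y1_iff[of y] unfolding Y1_def by blast
  have supp_Y2: "{i. y i \<noteq> 0} \<noteq> {} \<and> {i. y i \<noteq> 0} \<subseteq> W2" if "y \<in> Y2" for y
    using that support_nonempty sub(3) Y2_iff[of y] unfolding Y2_def by blast
  have sum_prod: "(\<Sum>v \<in> V. h (f v, g v)) = (\<Sum>i \<in> W1. \<Sum>j \<in> W2. h (i, j))" for h :: "_ \<Rightarrow> real"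
    using sum.reindex_bij_betw[OF bij, of h] by (simp add: sum.cartesian_product)
  have supp_r_img: "f ` {v. r (y1, y2) v \<noteq> 0} = {i. y1 i \<noteq> 0}"
      "g ` {v. r (y1, y2) v \<noteq> 0} = {j. y2 j \<noteq> 0}" if "y1 \<in> Y1" "y2 \<in> Y2" for y1 y2
    using img[of "{i. y1 i \<noteq> 0}" "{j. y2 j \<noteq> 0}"] supp_Y1[OF that(1)] supp_Y2[OF that(2)]
    unfolding supp_r by blast+
  have r_in: "r (y1, y2) \<in> X" if y: "y1 \<in> Y1" "y2 \<in> Y2" for y1 y2
  proof -
    have "{v. r (y1, y2) v \<noteq> 0} \<subseteq> V" by (auto simp: r_def)
    then have "{v. r (y1, y2) v \<noteq> 0} \<in> K"
      using y K supp_r_img[OF y] by (simp add: Y1_iff Y2_iff)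
    moreover have "(\<Sum>v \<in> V. r (y1, y2) v) = (\<Sum>i \<in> W1. y1 i) * (\<Sum>j \<in> W2. y2 j)"
      using sum_prod[of "\<lambda>(i, j). y1 i * y2 j"] by (simp add: r_def sum_product)
    ultimately show ?thesis using y by (simp add: X_iff Y1_iff Y2_iff) (simp add: r_def)
  qed
  have m1_in: "marginal V f x \<in> Y1" if "x \<in> X" for x
    unfolding Y1_def
    by (rule marginal_in_realization_points[OF fin(1,2) fV sub(1,2)])
      (use K sub that in \<open>auto simp: X_def\<close>)
  have m2_in: "marginal V g x \<in> Y2" if "x \<in> X" for x
    unfolding Y2_def
    by (rule marginal_in_realization_points[OF fin(1,3) gV sub(1,3)])
      (use K sub that in \<open>auto simp: X_def\<close>)
  \<comment> \<open>Each factor has total mass 1, so summing it out leaves the other one: on this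
    side the composition is exactly the identity.\<close>
  have "m (r (y1, y2)) = (y1, y2)" if y: "y1 \<in> Y1" "y2 \<in> Y2" for y1 y2
  proof -
    have s1: "(\<Sum>i \<in> W1. y1 i) = 1" and s2: "(\<Sum>j \<in> W2. y2 j) = 1"
      using y by (simp_all add: Y1_iff Y2_iff)
    have "marginal V f (r (y1, y2)) i = y1 i" for i
    proof -
      have "marginal V f (r (y1, y2)) i =
          (\<Sum>v \<in> V. if f v = i then y1 (f v) * y2 (g v) else 0)"
        unfolding marginal_def sum.inter_filter[OF fin(1)] by (intro sum.cong) (auto simp: r_def)
      also have "\<dots> = (\<Sum>k \<in> W1. \<Sum>j \<in> W2. if k = i then y1 k * y2 j else 0)"
        using sum_prod[of "\<lambda>(k, j). if k = i then y1 k * y2 j else 0"] by simp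
      also have "\<dots> = (\<Sum>k \<in> W1. if k = i then y1 k else 0)"
        using s2 by (intro sum.cong) (auto simp flip: sum_distrib_left)
      \<comment> \<open>For \<open>i\<close> outside \<open>W1\<close> the sum is 0, and so is
        \<open>y1 i\<close>, since points vanish off the vertex set.\<close>
      also have "\<dots> = y1 i"
        using fin realization_points_outside[OF sub(2), of y1 i] y by (auto simp: Y1_def)
      finally show ?thesis .
    qed
    moreover have "marginal V g (r (y1, y2)) j = y2 j" for j
    proof -
      have "marginal V g (r (y1, y2)) j =
          (\<Sum>v \<in> V. if g v = j then y1 (f v) * y2 (g v) else 0)"
        unfolding marginal_def sum.inter_filter[OF fin(1)] by (intro sum.cong) (auto simp: r_def)
      also have "\<dots> = (\<Sum>i \<in> W1. \<Sum>k \<in> W2. if k = j then y1 i * y2 k else 0)"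
        using sum_prod[of "\<lambda>(i, k). if k = j then y1 i * y2 k else 0"] by simp
      also have "\<dots> = (\<Sum>k \<in> W2. if k = j then y2 k else 0)"
        using s1 by (subst sum.swap, intro sum.cong) (auto simp flip: sum_distrib_right)
      also have "\<dots> = y2 j"
        using fin realization_points_outside[OF sub(3), of y2 j] y by (auto simp: Y2_def)
      finally show ?thesis .
    qed
    ultimately show ?thesis by (auto simp: m_def)
  qed
  then have "homotopic_with (\<lambda>x. True) (top_of_set (Y1 \<times> Y2)) (top_of_set (Y1 \<times> Y2)) id (m \<circ> r)"
    by (intro homotopic_with_equal continuous_map_id) auto
  then have mr: "homotopic_with (\<lambda>x. True) (top_of_set (Y1 \<times> Y2)) (top_of_set (Y1 \<times> Y2)) (m \<circ> r) id"
    by (rule homotopic_with_symD)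
  have cont_m: "continuous_on X m"
    unfolding m_def by (intro continuous_on_Pair continuous_on_marginal)
  have cont_coord: "continuous_on S (\<lambda>z. h z i)" if "continuous_on S h"
    for S :: "'d::topological_space set" and h :: "'d \<Rightarrow> 'e \<Rightarrow> real" and i
    using continuous_on_compose2[OF continuous_on_product_coordinates that] by simp
  have cont_r: "continuous_on S r" for S
  proof (rule continuous_on_coordinatewise_then_product)
    show "continuous_on S (\<lambda>y. r y v)" for v
      unfolding r_def case_prod_unfold
      by (cases "v \<in> V") (simp_all add: continuous_on_mult
          cont_coord[OF continuous_on_fst[OF continuous_on_id]]
          cont_coord[OF continuous_on_snd[OF continuous_on_id]])
  qed
  have rm: "homotopic_with (\<lambda>x. True) (top_of_set X) (top_of_set X) (r \<circ> m) id"
    unfolding homotopic_with_def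
  proof (intro exI conjI)
    \<comment> \<open>The straight line from the product of the marginals at time 0 to
      \<open>x\<close> at time 1.\<close>
    let ?h = "\<lambda>(\<tau>, x) v. (1 - \<tau>) * r (m x) v + \<tau> * x v"
    have "continuous_on ({0..1::real} \<times> X) (\<lambda>z. m (snd z))"
      by (rule continuous_on_compose2[OF cont_m]) (auto intro: continuous_intros)
    then have "continuous_on ({0..1::real} \<times> X) (\<lambda>z. r (m (snd z)))"
      by (rule continuous_on_compose2[OF cont_r[of UNIV]]) auto
    then have "continuous_on ({0..1} \<times> X) ?h"
      unfolding case_prod_unfold
      by (intro continuous_on_coordinatewise_then_product continuous_on_add continuous_on_mult
          continuous_on_diff continuous_on_const)
        (auto intro: continuous_intros cont_coord
          cont_coord[OF continuous_on_snd[OF continuous_on_id]])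
    moreover have "?h (\<tau>, x) \<in> X" if "\<tau> \<in> {0..1}" "x \<in> X" for \<tau> x
    \<comment> \<open>At the two endpoints one summand drops out, and the support need not be the
      union of both supports; there membership is immediate.\<close>
    proof (cases "\<tau> \<in> {0<..<1}")
      case False
      then have "\<tau> = 0 \<or> \<tau> = 1" using that by auto
      then show ?thesis using that r_in m1_in m2_in by (auto simp: m_def)
    next
      case True
      have rmX: "r (m x) \<in> X" using that r_in m1_in m2_in by (simp add: m_def)
      have nn: "0 \<le> x v" "0 \<le> r (m x) v" for v
        using that rmX X_iff by auto
      have S: "{v. x v \<noteq> 0} \<in> K" using that X_iff by auto
      then have SV: "{v. x v \<noteq> 0} \<subseteq> V" using sub by auto
      have S': "{v. r (m x) v \<noteq> 0} \<subseteq> V" by (auto simp: r_def m_def)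
      have "f ` {v. r (m x) v \<noteq> 0} = f ` {v. x v \<noteq> 0}"
           "g ` {v. r (m x) v \<noteq> 0} = g ` {v. x v \<noteq> 0}"
        unfolding m_def supp_r_img[OF m1_in[OF that(2)] m2_in[OF that(2)]]
        by (rule support_marginal[OF fin(1) nn(1) SV])+
      then have "f ` ({v. x v \<noteq> 0} \<union> {v. r (m x) v \<noteq> 0}) \<in> L1"
           "g ` ({v. x v \<noteq> 0} \<union> {v. r (m x) v \<noteq> 0}) \<in> L2"
        using K[OF SV] S by (simp_all add: image_Un)
      then have "{v. x v \<noteq> 0} \<union> {v. r (m x) v \<noteq> 0} \<in> K"
        using K[of "{v. x v \<noteq> 0} \<union> {v. r (m x) v \<noteq> 0}"] SV S' by simp
      \<comment> \<open>Both weights are positive and both coordinates nonnegative, so nothing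
        cancels.\<close>
      moreover have "?h (\<tau>, x) v = 0 \<longleftrightarrow> x v = 0 \<and> r (m x) v = 0" for v
        using nn[of v] True by (auto simp: add_nonneg_eq_0_iff)
      then have "{v. ?h (\<tau>, x) v \<noteq> 0} = {v. x v \<noteq> 0} \<union> {v. r (m x) v \<noteq> 0}" by auto
      ultimately have "{v. ?h (\<tau>, x) v \<noteq> 0} \<in> K" by simp
      moreover have "(\<Sum>v \<in> V. ?h (\<tau>, x) v) = 1"
        using that(2) rmX by (simp add: X_iff sum.distrib flip: sum_distrib_left)
      moreover have "\<forall>v. 0 \<le> ?h (\<tau>, x) v" using nn True by auto
      ultimately show ?thesis unfolding X_iff by blast
    qed
    ultimately show "continuous_map (prod_topology (top_of_set {0..1}) (top_of_set X)) (top_of_set X) ?h"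
      by (auto simp: continuous_map_in_subtopology)
  qed auto
  have "top_of_set X homotopy_equivalent_space top_of_set (Y1 \<times> Y2)"
    unfolding homotopy_equivalent_space_def
  proof (intro exI conjI)
    show "continuous_map (top_of_set X) (top_of_set (Y1 \<times> Y2)) m"
      using cont_m m1_in m2_in by (auto simp: m_def)
    show "continuous_map (top_of_set (Y1 \<times> Y2)) (top_of_set X) r"
      using cont_r r_in by auto
  qed (use mr rm in auto)
  then show ?thesis by (simp add: geometric_realization_eq X_def Y1_def Y2_def)
qed

section \<open>Cycles\<close>

text \<open>The cycle graph on the residues modulo \<open>m\<close>. For \<open>m = 2\<close> its
  two edges coincide, so a circle arises only from \<open>m = 3\<close> on.\<close>

definition cycle_complex :: "int \<Rightarrow> int set set" where
  "cycle_complex m = {A. \<exists>i \<in> {0..<m}. A \<subseteq> {i, (i + 1) mod m}}"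

lemma cycle_complex_subset: "cycle_complex m \<subseteq> Pow {0..<m}"
proof -
  have "(i + 1) mod m \<in> {0..<m}" if "i \<in> {0..<m}" for i using that by auto
  then show ?thesis unfolding cycle_complex_def by blast
qed

text \<open>The point at parameter \<open>c\<close> on the edge from \<open>i\<close> to its
  successor; writing it as a sum lets the total mass be computed term by term.\<close>

definition edge_point :: "int \<Rightarrow> int \<Rightarrow> real \<Rightarrow> int \<Rightarrow> real" where
  "edge_point m i c v = (if v = i then 1 - c else 0) + (if v = (i + 1) mod m then c else 0)"

text \<open>
  The hat functions around the integers in \<open>{0..m}\<close>, evaluated at \<open>m * c\<close>; the vertex \<open>0\<close>
  gets both the hat around \<open>0\<close> and the one around \<open>m\<close>.
\<close>

definition cycle_loop :: "int \<Rightarrow> real \<Rightarrow> int \<Rightarrow> real" where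
  "cycle_loop m c v =
     (if v \<in> {0..<m} then max 0 (1 - \<bar>m * c - v\<bar>) else 0) +
     (if v = 0 then max 0 (1 - \<bar>m * c - m\<bar>) else 0)"

lemma succ_mod_eq: "(i + 1) mod m = (if i + 1 = m then 0 else i + 1)" if "i \<in> {0..<m}" for i m :: int
  using that by auto

text \<open>Between \<open>i\<close> and \<open>i + 1\<close> only the hats around these two
  integers can be nonzero, with heights \<open>1 - c\<close> and \<open>c\<close>.\<close>

lemma cycle_loop_eq:
  fixes m i :: int and c d :: real
  assumes "m \<ge> 2" "i \<in> {0..<m}" "c \<in> {0..1}" "m * d = i + c"
  shows "cycle_loop m d = edge_point m i c"
proof
  fix v :: int
  have hat: "max 0 (1 - \<bar>i + c - k\<bar>) = (if k = i then 1 - c else if k = i + 1 then c else 0)"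
    for k :: int
  proof -
    consider "k = i" | "k = i + 1" | "k \<le> i - 1" | "k \<ge> i + 2" by linarith
    then show ?thesis
    proof cases
      case 3
      then have "real_of_int k \<le> i - 1" by linarith
      then show ?thesis using 3 assms by auto
    next
      case 4
      then have "real_of_int k \<ge> i + 2" by linarith
      then show ?thesis using 4 assms by auto
    qed (use assms in auto)
  qed
  \<comment> \<open>On the last edge, \<open>i = m - 1\<close>, it is the hat around
    \<open>m\<close> that gives vertex 0 its weight \<open>c\<close>.\<close>
  show "cycle_loop m d v = edge_point m i c v"
    unfolding cycle_loop_def edge_point_def assms(4) hat succ_mod_eq[OF assms(2)]
    using assms by auto
qed

text \<open>Integer and fractional part of \<open>m * c\<close>. At \<open>c = 1\<close> the integer
  part \<open>m\<close> is out of range, and the end of the last edge serves instead.\<close>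

lemma edge_coordinates:
  fixes c :: real and m :: int
  assumes "m > 0" "c \<in> {0..1}"
  obtains i :: int and d :: real where "i \<in> {0..<m}" "d \<in> {0..1}" "m * c = real_of_int i + d" "c < 1 \<Longrightarrow> d < 1"
proof (cases "c = 1")
  case True
  then show ?thesis using assms that[of "m - 1" 1] by simp
next
  case False
  have "\<lfloor>m * c\<rfloor> < m" using False assms by (auto simp: floor_less_iff)
  moreover have "\<lfloor>m * c\<rfloor> \<ge> 0" using assms by simp
  ultimately show ?thesis
    by (intro that[of "\<lfloor>m * c\<rfloor>" "frac (m * c)"]) (auto simp: frac_def, linarith+)
qed

text \<open>With parameters below 1 the start vertex of an edge has positive weight, so equality
  puts each start vertex on the other edge.\<close>

lemma edge_point_inj:
  fixes m i j :: int and c d :: real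
  assumes "m \<ge> 3" "i \<in> {0..<m}" "j \<in> {0..<m}" "c \<in> {0..<1}" "d \<in> {0..<1}"
    and eq: "edge_point m i c = edge_point m j d"
  shows "i = j \<and> c = d"
proof -
  have at: "edge_point m i c v = edge_point m j d v" for v using eq by simp
  have ne: "(i + 1) mod m \<noteq> i" "(j + 1) mod m \<noteq> j"
    using assms succ_mod_eq[OF assms(2)] succ_mod_eq[OF assms(3)] by auto
  have at_start: "edge_point m i c i = 1 - c" "edge_point m j d j = 1 - d"
    using ne[symmetric] by (simp_all only: edge_point_def simp_thms if_True if_False add_0_right)
  have "i = j"
  proof (rule ccontr)
    assume "i \<noteq> j"
    have supp: "v = k \<or> v = (k + 1) mod m" if "edge_point m k e v \<noteq> 0" for k e v
      using that by (auto simp: edge_point_def split: if_splits)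
    have "edge_point m j d i \<noteq> 0" "edge_point m i c j \<noteq> 0"
      using at[of i] at[of j] at_start assms(4,5) by simp_all
    then have "i = (j + 1) mod m" "j = (i + 1) mod m"
      using supp \<open>i \<noteq> j\<close> by blast+
    then have "i = j + 1 \<or> i = 0 \<and> j + 1 = m" "j = i + 1 \<or> j = 0 \<and> i + 1 = m"
      using succ_mod_eq[OF assms(2)] succ_mod_eq[OF assms(3)] by metis+
    \<comment> \<open>Two vertices each following the other form a cycle of length 2.\<close>
    then show False using assms(1) by linarith
  qed
  then show ?thesis using at[of i] at_start by simp
qed

lemma edge_point_in_realization:
  assumes "m \<ge> 2" "i \<in> {0..<m}" "c \<in> {0..1}"
  shows "edge_point m i c \<in> realization_points (cycle_complex m)"
proof -
  have "{v. edge_point m i c v \<noteq> 0} \<subseteq> {i, (i + 1) mod m}" by (auto simp: edge_point_def)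
  then have "{v. edge_point m i c v \<noteq> 0} \<in> cycle_complex m"
    using assms by (auto simp: cycle_complex_def)
  moreover have "(\<Sum>v \<in> {0..<m}. edge_point m i c v) = 1"
    using assms by (simp add: edge_point_def sum.distrib)
  ultimately show ?thesis
    using assms by (simp add: realization_points_iff[OF _ cycle_complex_subset])
      (simp add: edge_point_def)
qed

text \<open>The parameter is the weight of the successor vertex; the ends of an edge differ for
  \<open>m \<ge> 2\<close>, so their weights add up to 1.\<close>

lemma realization_cycle_edge_point:
  assumes "m \<ge> 2" "x \<in> realization_points (cycle_complex m)"
  obtains i c where "i \<in> {0..<m}" "c \<in> {0..1}" "x = edge_point m i c"
proof -
  have nn: "\<And>v. 0 \<le> x v" and C: "{v. x v \<noteq> 0} \<in> cycle_complex m"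
    and one: "(\<Sum>v \<in> {0..<m}. x v) = 1"
    using assms realization_points_iff[OF _ cycle_complex_subset, of m x] by auto
  obtain i where i: "i \<in> {0..<m}" "{v. x v \<noteq> 0} \<subseteq> {i, (i + 1) mod m}"
    using C by (auto simp: cycle_complex_def)
  have ne: "i \<noteq> (i + 1) mod m" using assms i succ_mod_eq[OF i(1)] by auto
  have "(\<Sum>v \<in> {0..<m}. x v) = (\<Sum>v \<in> {i, (i + 1) mod m}. x v)"
    using i assms by (intro sum.mono_neutral_right) auto
  then have "x i + x ((i + 1) mod m) = 1" using ne one by simp
  moreover have "x v = 0" if "v \<noteq> i" "v \<noteq> (i + 1) mod m" for v using i that by auto
  ultimately have "x = edge_point m i (x ((i + 1) mod m))"
    using ne by (intro ext) (auto simp: edge_point_def)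
  moreover have "x ((i + 1) mod m) \<in> {0..1}"
    using nn[of i] nn[of "(i + 1) mod m"] \<open>x i + x ((i + 1) mod m) = 1\<close> by simp
  ultimately show ?thesis using that i by blast
qed

section \<open>The cycle as a simple closed curve\<close>

lemma cycle_loop_closed: "m \<ge> 2 \<Longrightarrow> cycle_loop m 1 = cycle_loop m 0"
  by (auto simp: fun_eq_iff cycle_loop_def max_def)

lemma cycle_loop_inj:
  assumes "m \<ge> 3" "c \<in> {0..<1}" "d \<in> {0..<1}" "cycle_loop m c = cycle_loop m d"
  shows "c = d"
proof -
  obtain i and c' :: real where i: "i \<in> {0..<m}" "c' \<in> {0..1}" "m * c = real_of_int i + c'" "c' < 1"
    using edge_coordinates[of m c] assms by auto
  obtain j and d' :: real where j: "j \<in> {0..<m}" "d' \<in> {0..1}" "m * d = real_of_int j + d'" "d' < 1"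
    using edge_coordinates[of m d] assms by auto
  have "edge_point m i c' = edge_point m j d'"
    using cycle_loop_eq[of m i c' c] cycle_loop_eq[of m j d' d] i j assms by simp
  then have "i = j \<and> c' = d'" using i j assms by (intro edge_point_inj) auto
  then have "m * c = m * d" using i j by simp
  then show ?thesis using assms by simp
qed

lemma simple_path_cycle_loop:
  assumes "m \<ge> 3"
  shows "simple_path (cycle_loop m)"
  unfolding simple_path_def
proof
  show "path (cycle_loop m)"
    unfolding path_def
  proof (rule continuous_on_coordinatewise_then_product)
    show "continuous_on {0..1} (\<lambda>c. cycle_loop m c v)" for v
      unfolding cycle_loop_def by (cases "v = 0"; cases "v \<in> {0..<m}") (auto intro!: continuous_intros)
  qed
  have "c = d \<or> c = 0 \<and> d = 1 \<or> c = 1 \<and> d = 0"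
    if "c \<in> {0..1}" "d \<in> {0..1}" "cycle_loop m c = cycle_loop m d" for c d
  proof -
    \<comment> \<open>\<open>red\<close> moves the parameter 1 to 0, where the loop has the same
      value, so that injectivity on \<open>{0..<1}\<close> applies.\<close>
    define red where "red = (\<lambda>c::real. if c = 1 then 0 else c)"
    have "cycle_loop m (red c) = cycle_loop m (red d)"
      using that cycle_loop_closed[of m] assms by (auto simp: red_def)
    then have "red c = red d"
      using that assms by (intro cycle_loop_inj[of m]) (auto simp: red_def)
    then show ?thesis by (auto simp: red_def split: if_splits)
  qed
  then show "loop_free (cycle_loop m)" by (auto simp: loop_free_def)
qed

lemma path_image_cycle_loop:
  assumes "m \<ge> 2"
  shows "path_image (cycle_loop m) = realization_points (cycle_complex m)"
proof
  show "path_image (cycle_loop m) \<subseteq> realization_points (cycle_complex m)"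
  proof
    fix x assume "x \<in> path_image (cycle_loop m)"
    then obtain c where c: "c \<in> {0..1}" "x = cycle_loop m c" by (auto simp: path_image_def)
    obtain i d where "i \<in> {0..<m}" "d \<in> {0..1}" "m * c = real_of_int i + d"
      by (rule edge_coordinates[of m c]) (use assms c in auto)
    then show "x \<in> realization_points (cycle_complex m)"
      using c assms cycle_loop_eq[of m i d c] edge_point_in_realization by simp
  qed
  show "realization_points (cycle_complex m) \<subseteq> path_image (cycle_loop m)"
  proof
    fix x assume "x \<in> realization_points (cycle_complex m)"
    then obtain i c where i: "i \<in> {0..<m}" "c \<in> {0..1}" "x = edge_point m i c"
      using realization_cycle_edge_point assms by blast
    have "real_of_int i + 1 \<le> m" using i by auto
    then have "(i + c) / m \<in> {0..1}" using i assms by (auto simp: field_simps)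
    moreover have "x = cycle_loop m ((i + c) / m)"
      using cycle_loop_eq[of m i c "(i + c) / m"] i assms by simp
    ultimately show "x \<in> path_image (cycle_loop m)" by (auto simp: path_image_def)
  qed
qed

text \<open>The realization is the image of a simple closed path, and every such image is
  homeomorphic to the circle.\<close>

lemma geometric_realization_cycle_complex:
  assumes "m \<ge> 3"
  shows "geometric_realization (cycle_complex m) homeomorphic_space
           top_of_set (sphere (0::complex) 1)"
proof -
  have "path_image (cycle_loop m) homeomorphic sphere (0::complex) 1"
    using assms simple_path_cycle_loop cycle_loop_closed
    by (intro homeomorphic_simple_path_image_circle) (auto simp: pathfinish_def pathstart_def)
  then have "realization_points (cycle_complex m) homeomorphic sphere (0::complex) 1"
    using assms by (simp add: path_image_cycle_loop)
  then obtain f g where "homeomorphism (realization_points (cycle_complex m)) (sphere (0::complex) 1) f g"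
    by (auto simp: homeomorphic_def)
  then have "homeomorphic_maps (geometric_realization (cycle_complex m)) (top_of_set (sphere 0 1)) f g"
    by (auto simp: geometric_realization_eq homeomorphism_def homeomorphic_maps_def)
  then show ?thesis by (auto simp: homeomorphic_space_def)
qed

section \<open>The neighbourhood complex of a circulant graph\<close>

text \<open>The neighbours \<open>w - t\<close>, \<open>w + s\<close>, \<open>w - s\<close>,
  \<open>w + t\<close> are the four shifts of \<open>u = w - t\<close>. Letting \<open>u\<close> be
  any integer frees later arguments from the representatives \<open>{1..n}\<close>.\<close>

lemma in_neighborhood_complex_circulant_graph:
  fixes n s t :: int
  assumes "s \<in> {1..n - 1}" "t \<in> {1..n - 1}" "A \<subseteq> {1..n}"
  shows "A \<in> neighborhood_complex (circulant_graph n s t) \<longleftrightarrow>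
    (\<exists>u. \<forall>v \<in> A. \<exists>e \<in> {0, s + t, t - s, (s + t) + (t - s)}. [v = u + e] (mod n))"
proof -
  have nbr: "(v - w) mod n \<in> {s, t, n - s, n - t} \<longleftrightarrow>
      (\<exists>e \<in> {0, s + t, t - s, (s + t) + (t - s)}. [v = w - t + e] (mod n))" for v w
  proof -
    have "(v - w) mod n = d \<longleftrightarrow> [v = w + d] (mod n)" if "0 \<le> d" "d < n" for d
    proof -
      have "(v - w) mod n = d \<longleftrightarrow> [v - w = d] (mod n)" using that by (simp add: cong_def)
      then show ?thesis by (simp add: cong_iff_dvd_diff algebra_simps)
    qed
    then have "(v - w) mod n \<in> {s, t, n - s, n - t} \<longleftrightarrow> [v = w + s] (mod n) \<or> [v = w + t] (mod n)
        \<or> [v = w + (n - s)] (mod n) \<or> [v = w + (n - t)] (mod n)"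
      using assms by auto
    moreover have "[v = w + (n - d)] (mod n) \<longleftrightarrow> [v = w - d] (mod n)" for d
    proof -
      have "w + (n - d) = w - d + n" by simp
      then show ?thesis by (simp only: cong_def mod_add_self2)
    qed
    ultimately show ?thesis by (auto simp: algebra_simps)
  qed
  show ?thesis
  proof
    assume "A \<in> neighborhood_complex (circulant_graph n s t)"
    then obtain w where "\<forall>v \<in> A. (v - w) mod n \<in> {s, t, n - s, n - t}"
      by (auto simp: neighborhood_complex_def circulant_graph_def)
    then show "\<exists>u. \<forall>v \<in> A. \<exists>e \<in> {0, s + t, t - s, (s + t) + (t - s)}. [v = u + e] (mod n)"
      unfolding nbr by blast
  next
    assume "\<exists>u. \<forall>v \<in> A. \<exists>e \<in> {0, s + t, t - s, (s + t) + (t - s)}. [v = u + e] (mod n)"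
    then obtain u where u: "\<forall>v \<in> A. \<exists>e \<in> {0, s + t, t - s, (s + t) + (t - s)}. [v = u + e] (mod n)"
      by blast
    \<comment> \<open>The representative of \<open>u + t\<close> in \<open>{1..n}\<close>:
      subtracting 1 before \<open>mod\<close> and adding it afterwards shifts the range
      \<open>{0..<n}\<close>.\<close>
    define w where "w = (u + t - 1) mod n + 1"
    have "0 \<le> (u + t - 1) mod n" "(u + t - 1) mod n < n" using assms by auto
    then have w: "w \<in> {1..n}" by (simp add: w_def)
    have "[(u + t - 1) mod n + (1 - t) = (u + t - 1) + (1 - t)] (mod n)"
      by (intro cong_add cong_refl) simp
    then have "[w - t = u] (mod n)" by (simp add: w_def algebra_simps)
    then have "[w - t + e = u + e] (mod n)" for e by (intro cong_add cong_refl)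
    then have "\<forall>v \<in> A. \<exists>e \<in> {0, s + t, t - s, (s + t) + (t - s)}. [v = w - t + e] (mod n)"
      using u by (meson cong_sym cong_trans)
    then show "A \<in> neighborhood_complex (circulant_graph n s t)"
      unfolding nbr[symmetric] neighborhood_complex_def circulant_graph_def
      using w assms(3) by (intro CollectI conjI bexI[of _ w]) (auto simp: subset_iff)
  qed
qed

text \<open>This covers both parameter families at once; \<open>p \<ge> 3\<close> and
  \<open>q \<ge> 3\<close> make both cycles circles.\<close>

lemma neighborhood_complex_circulant_graph_torus:
  fixes n p q s t :: int
  assumes n: "n = p * q" "coprime p q" "p \<ge> 3" "q \<ge> 3"
    and st: "s \<in> {1..n - 1}" "t \<in> {1..n - 1}"
    and a: "p dvd s + t" "coprime (s + t) q" and b: "q dvd t - s" "coprime (t - s) p"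
  shows "geometric_realization (neighborhood_complex (circulant_graph n s t))
           homotopy_equivalent_space torus"
proof -
  define a b where "a = s + t" and "b = t - s"
  define K where "K = neighborhood_complex (circulant_graph n s t)"
  obtain a' where a': "[a * a' = 1] (mod q)"
    using a(2) cong_solve_coprime_int unfolding a_def by blast
  obtain b' where b': "[b * b' = 1] (mod p)"
    using b(2) cong_solve_coprime_int unfolding b_def by blast
  \<comment> \<open>Grid coordinates: multiplying by the inverse \<open>a'\<close> rescales residues
    modulo \<open>q\<close> so that adding \<open>a\<close> advances \<open>f\<close> by 1; likewise
    \<open>b'\<close> for \<open>g\<close> modulo \<open>p\<close>.\<close>
  define f g where "f = (\<lambda>v. v * a' mod q)" and "g = (\<lambda>v. v * b' mod p)"
  define f g where "f = (\<lambda>v. v * a' mod q)" and "g = (\<lambda>v. v * b' mod p)"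
  have ab: "[a = 0] (mod p)" "[b = 0] (mod q)"
    using a b by (auto simp: a_def b_def cong_0_iff)
  have cong_n: "[x = y] (mod n) \<longleftrightarrow> [x = y] (mod p) \<and> [x = y] (mod q)" for x y
    unfolding n(1) using n(2) by (auto simp: cong_iff_dvd_diff intro: divides_mult dvd_mult_left dvd_mult_right)
  have unit: "coprime a' q" "coprime b' p"
    using a' b' by (metis cong_imp_coprime cong_sym coprime_1_left coprime_mult_left_iff)+
  have f_iff: "f v = f u \<longleftrightarrow> [v = u] (mod q)" for u v
    using cong_mult_rcancel[OF unit(1)] by (simp add: f_def flip: cong_def)
  have g_iff: "g v = g u \<longleftrightarrow> [v = u] (mod p)" for u v
    using cong_mult_rcancel[OF unit(2)] by (simp add: g_def flip: cong_def)
  have f_add: "f (u + a) = (f u + 1) mod q" for u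
  proof -
    have "[(u + a) * a' = u * a' + 1] (mod q)"
      using cong_add[OF cong_refl a', of "u * a'"] by (simp add: algebra_simps)
    then show ?thesis by (simp add: f_def cong_def mod_simps)
  qed
  have g_add: "g (u + b) = (g u + 1) mod p" for u
  proof -
    have "[(u + b) * b' = u * b' + 1] (mod p)"
      using cong_add[OF cong_refl b', of "u * b'"] by (simp add: algebra_simps)
    then show ?thesis by (simp add: g_def cong_def mod_simps)
  qed
  \<comment> \<open>Each step moves one coordinate only, as \<open>b\<close> vanishes modulo
    \<open>q\<close> and \<open>a\<close> modulo \<open>p\<close>.\<close>
  have drop: "[v = u + b] (mod q) \<longleftrightarrow> [v = u] (mod q)" "[v = u + (a + b)] (mod q) \<longleftrightarrow> [v = u + a] (mod q)"
      "[v = u + a] (mod p) \<longleftrightarrow> [v = u] (mod p)" "[v = u + (a + b)] (mod p) \<longleftrightarrow> [v = u + b] (mod p)"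
    for u v
  proof -
    have q: "[x + b = x] (mod q)" and p: "[x + a = x] (mod p)" for x
      using ab cong_add[OF cong_refl, of _ 0 _ x] by fastforce+
    show "[v = u + b] (mod q) \<longleftrightarrow> [v = u] (mod q)" "[v = u + a] (mod p) \<longleftrightarrow> [v = u] (mod p)"
      using q[of u] p[of u] by (auto simp: cong_def)
    show "[v = u + (a + b)] (mod q) \<longleftrightarrow> [v = u + a] (mod q)"
      using q[of "u + a"] by (auto simp: cong_def add.assoc)
    show "[v = u + (a + b)] (mod p) \<longleftrightarrow> [v = u + b] (mod p)"
      using p[of "u + b"] by (auto simp: cong_def algebra_simps)
  qed
  \<comment> \<open>The four shifts amount to choosing independently whether to advance
    \<open>f\<close> and whether to advance \<open>g\<close>.\<close>
  have square: "(\<exists>e \<in> {0, a, b, a + b}. [v = u + e] (mod n)) \<longleftrightarrow>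
      f v \<in> {f u, (f u + 1) mod q} \<and> g v \<in> {g u, (g u + 1) mod p}" for u v
    unfolding f_add[symmetric] g_add[symmetric] by (auto simp: cong_n f_iff g_iff drop)
  have fg_in: "f v \<in> {0..<q}" "g v \<in> {0..<p}" for v
    using n by (auto simp: f_def g_def)
  have "inj_on (\<lambda>v. (f v, g v)) {1..n}"
  proof (rule inj_onI)
    fix v u assume vu: "v \<in> {1..n}" "u \<in> {1..n}" and "(f v, g v) = (f u, g u)"
    then have "[v = u] (mod n)" by (simp add: cong_n f_iff g_iff)
    then have "[v - 1 = u - 1] (mod n)" by (intro cong_diff cong_refl)
    then have "v - 1 = u - 1" using vu by (intro cong_less_imp_eq_int[of _ n]) auto
    then show "v = u" by simp
  qed
  \<comment> \<open>Equal cardinalities turn injectivity into bijectivity, which is the existence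
    half of the Chinese remainder theorem.\<close>
  moreover have "card ({0..<q} \<times> {0..<p}) = card {1..n}"
    using n by (simp add: card_cartesian_product nat_mult_distrib)
  moreover have sub: "(\<lambda>v. (f v, g v)) ` {1..n} \<subseteq> {0..<q} \<times> {0..<p}" using fg_in by auto
  ultimately have bij: "bij_betw (\<lambda>v. (f v, g v)) {1..n} ({0..<q} \<times> {0..<p})"
    unfolding bij_betw_def by (simp add: card_image card_subset_eq)
  have K: "A \<in> K \<longleftrightarrow> f ` A \<in> cycle_complex q \<and> g ` A \<in> cycle_complex p" if "A \<subseteq> {1..n}" for A
  proof -
    have "A \<in> K \<longleftrightarrow> (\<exists>u. \<forall>v \<in> A. \<exists>e \<in> {0, a, b, a + b}. [v = u + e] (mod n))"
      unfolding K_def a_def b_def by (rule in_neighborhood_complex_circulant_graph[OF st that])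
    also have "\<dots> \<longleftrightarrow> (\<exists>u. f ` A \<subseteq> {f u, (f u + 1) mod q} \<and> g ` A \<subseteq> {g u, (g u + 1) mod p})"
      unfolding square by blast
    also have "\<dots> \<longleftrightarrow> (\<exists>i \<in> {0..<q}. \<exists>j \<in> {0..<p}.
        f ` A \<subseteq> {i, (i + 1) mod q} \<and> g ` A \<subseteq> {j, (j + 1) mod p})"
    proof
      assume "\<exists>i \<in> {0..<q}. \<exists>j \<in> {0..<p}.
        f ` A \<subseteq> {i, (i + 1) mod q} \<and> g ` A \<subseteq> {j, (j + 1) mod p}"
      then obtain i j where ij: "(i, j) \<in> {0..<q} \<times> {0..<p}"
        "f ` A \<subseteq> {i, (i + 1) mod q}" "g ` A \<subseteq> {j, (j + 1) mod p}" by auto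
      \<comment> \<open>By surjectivity one \<open>u\<close> realizes both start vertices, so the
        two edges can be chosen independently.\<close>
      then have "(i, j) \<in> (\<lambda>v. (f v, g v)) ` {1..n}" using bij by (simp add: bij_betw_def)
      then obtain u where "f u = i" "g u = j" by auto
      then show "\<exists>u. f ` A \<subseteq> {f u, (f u + 1) mod q} \<and> g ` A \<subseteq> {g u, (g u + 1) mod p}"
        using ij by blast
    qed (use fg_in in blast)
    finally show ?thesis unfolding cycle_complex_def by blast
  qed
  have "K \<subseteq> Pow {1..n}"
    by (auto simp: K_def neighborhood_complex_def circulant_graph_def)
  then have "geometric_realization K homotopy_equivalent_space
      prod_topology (geometric_realization (cycle_complex q)) (geometric_realization (cycle_complex p))"
    using bij K cycle_complex_subset by (intro geometric_realization_categorical_product) auto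
  also have "\<dots> homotopy_equivalent_space torus"
    unfolding torus_def using n
    by (intro homeomorphic_imp_homotopy_equivalent_space homeomorphic_space_prod_topology
        geometric_realization_cycle_complex)
  finally show ?thesis by (simp add: K_def)
qed

section \<open>Arithmetic of the two parameter families\<close>

theorem theorem2p6:
  fixes n p q s t :: int
  assumes "p > 0" and "q > 0" and "gcd p q = 1" and "n = p * q"
    and "s \<in> {1..n - 1}" and "t \<in> {1..n - 1}"
    and "[2 * s \<noteq> 0] (mod n)" and "[2 * t \<noteq> 0] (mod n)" and "[2 * (s + t) \<noteq> 0] (mod n)"
    and "[3 * s - t \<noteq> 0] (mod n)" and "[3 * t - s \<noteq> 0] (mod n)"
    and "[3 * s + t \<noteq> 0] (mod n)" and "[3 * t + s \<noteq> 0] (mod n)"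
    and "[4 * s \<noteq> 0] (mod n)" and "[4 * t \<noteq> 0] (mod n)"
    and "(real_of_int s = (real_of_int p - real_of_int q) / 2 \<and>
          real_of_int t = (real_of_int p + real_of_int q) / 2) \<or>
         (real_of_int s = ((real_of_int p)\<^sup>2 - real_of_int q) / 2 \<and>
          real_of_int t = ((real_of_int p)\<^sup>2 + real_of_int q) / 2)"
  shows "geometric_realization (neighborhood_complex (circulant_graph n s t))
           homotopy_equivalent_space torus"
proof -
  have coprime: "coprime p q" using assms(3) by (simp add: coprime_iff_gcd_eq_1)
  have "2 * s = p - q \<and> 2 * t = p + q \<or> 2 * s = p\<^sup>2 - q \<and> 2 * t = p\<^sup>2 + q"
  proof -
    have "real_of_int (2 * s) = real_of_int (p - q) \<and> real_of_int (2 * t) = real_of_int (p + q) \<or>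
        real_of_int (2 * s) = real_of_int (p\<^sup>2 - q) \<and> real_of_int (2 * t) = real_of_int (p\<^sup>2 + q)"
      using assms(16) by auto
    then show ?thesis by (simp only: of_int_eq_iff)
  qed
  \<comment> \<open>With \<open>a = s + t\<close> both families are treated together: only
    \<open>p dvd a\<close> and \<open>coprime a q\<close> matter for the grid, while
    \<open>t - s = q\<close> in either case.\<close>
  then obtain a where a: "a = p \<or> a = p\<^sup>2" and s2: "2 * s = a - q" and t2: "2 * t = a + q"
    by blast
  have st: "s + t = a" "t - s = q" using s2 t2 by auto
  have pa: "p dvd a" "coprime a q" using a coprime by auto
  \<comment> \<open>\<open>a\<close> and \<open>q\<close> differ by the even number
    \<open>2 * s\<close>, and coprimality excludes that both are even.\<close>
  have "even a \<longleftrightarrow> even q" using s2 by presburger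
  then have odd: "odd p" "odd q" using a coprime by auto
  \<comment> \<open>\<open>p = 1\<close> would give \<open>2 * s = 1 - q\<close>, which is not
    positive.\<close>
  have "p \<noteq> 1" using a s2 assms(2,5) by auto
  \<comment> \<open>\<open>q = 1\<close> would give \<open>n = p\<close>, a divisor of
    \<open>s + t\<close>, against the hypothesis on \<open>2 * (s + t)\<close>.\<close>
  moreover have "q \<noteq> 1"
  proof
    assume "q = 1"
    then have "n dvd 2 * (s + t)" using assms(4) pa st by simp
    then show False using assms(9) by (simp add: cong_0_iff)
  qed
  ultimately have "p \<noteq> 1" "p \<noteq> 2" "q \<noteq> 1" "q \<noteq> 2" using odd by auto
  then have "p \<ge> 3" "q \<ge> 3" using assms(1,2) by linarith+
  then show ?thesis
    using assms(4-6) coprime pa st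
    by (intro neighborhood_complex_circulant_graph_torus[where p = p and q = q])
      (auto simp: coprime_commute)
qed

end
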